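(* Let $\partial$ be a subdifferential and let $X$ be a real Banach space on which property (P2) (slope control) holds for $\partial$. Let $(f_n)_n$ be a sequence of lower semicontinuous functions $f_n:X\to\mathbb{R}\cup\{+\infty\}$ and $(\varphi_n)_n$ a sequence of convex Lipschitz functions $\varphi_n:X\to\mathbb{R}$ such that $(f_n+\varphi_n)_n$ is slice convergent to a lower semicontinuous function $f:X\to\mathbb{R}\cup\{+\infty\}$. Then, for each $(\bar z,\bar z^* )\in\partial_F f$ (that is, $\bar z^*\in\partial_F f(\bar z)$), there are elements $(x_n,x_n^* )\in\partial f_n$ and $(y_n,y_n^* )\in\partial\varphi_n$ such that $x_n\to\bar z$, $y_n\to\bar z$, $f_n(x_n)+\varphi_n(y_n)\to f(\bar z)$ and $x_n^*+y_n^*\to\bar z^*$.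
   Context: $\operatorname{LSC}(X)$ is the set of lower semicontinuous functions $X\to\mathbb{R}\cup\{+\infty\}$; $\operatorname{dom} f=\{x: f(x)<\infty\}$; $\operatorname{epi} f=\{(x,\alpha)\in X\times\mathbb{R}: f(x)\le\alpha\}$; $\operatorname{graph} f=\{(x,\alpha)\in X\times\mathbb{R}: f(x)=\alpha\}$; $x_n\to_f z$ means $x_n\to z$ and $f(x_n)\to f(z)$. $B_\lambda(x)$ is the closed ball of radius $\lambda$ centered at $x$ (with $B_0(x)=\{x\}$); $\delta_S$ is the indicator function of $S$ ($0$ on $S$, $+\infty$ elsewhere). $X\times\mathbb{R}$ carries the max norm. For subsets $A,B$ of a normed space, $D(A,B)=\inf\{\|a-b\|: a\in A,\ b\in B\}$ (with $\inf\emptyset=+\infty$). Convergence in $X^*$ is in norm. Slope: for $x\in\operatorname{dom} f$, $|\nabla f|(x):=\limsup_{y\to x,\,y\ne x}\frac{(f(x)-f(y))^+}{\|x-y\|}$, where $\alpha^+=\max(0,\alpha)$. Fréchet subdifferential: for $\bar x\in\operatorname{dom} f$, $\partial_F f(\bar x):=\{\bar x^*\in X^*:\liminf_{x\to\bar x,\,x\ne\bar x}\frac{f(x)-f(\bar x)-\langle\bar x^*,x-\bar x\rangle}{\|x-\bar x\|}\ge0\}$; equivalently, $\bar x^*\in\partial_F f(\bar x)$ if and only if $|\nabla(f-\bar x^* )|(\bar x)=0$. Slice convergence: $(g_n)_n\subset\operatorname{LSC}(X)$ is slice convergent to $f\in\operatorname{LSC}(X)$ if for every $x\in X$, every continuous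 affine $\varphi:X\to\mathbb{R}$ and every $\lambda\in[0,+\infty)$, writing $\varphi_\mu:=\varphi+\delta_{B_\mu(x)}$: (i) there is a sequence $x_n\to x$ in $X$ with $g_n(x_n)\to f(x)$; (ii) $D(\operatorname{graph}\varphi_\lambda,\operatorname{epi} f)>0$ implies $\sup_{\delta>0}\liminf_n D(\operatorname{graph}\varphi_{\lambda+\delta},\operatorname{epi} g_n)>0$. Subdifferential: an operator $\partial$ associating a set $\partial f(x)\subset X^*$ to any triplet $(X,f,x)$, where $X$ is a Banach space, $f\in\operatorname{LSC}(X)$ and $x\in X$, such that: (A1) if $f$ is convex near $x$, then $\partial f(x)=\{x^*\in X^*:\langle x^*,y-x\rangle+f(x)\le f(y)\ \ \forall y\in X\}$; (A2) if $F(x,y)=f(x)+g(y)$, then $\partial F(x,y)\subset\partial f(x)\times\partial g(y)$; (A3) for any $f$ and $x^*\in X^*$, $\partial(f+x^* )(x)=\partial f(x)+x^*$. We also write $\partial f=\{(x,x^* )\in X\times X^*: x^*\in\partial f(x)\}$ for the graph. Property (P2) on $X$: for any $f\in\operatorname{LSC}(X)$, any convex Lipschitz $\varphi:X\to\mathbb{R}$ and any $z\in\operatorname{dom} f$, there are sequences $((x_n,x_n^* ))_n\subset\partial f$ and $((y_n,y_n^* ))_n\subset\partial\varphi$ such that $x_n\to_f z$, $y_n\to z$ and $\limsup_n\|x_n^*+y_n^*\|\le|\nabla(f+\varphi)|(z)$.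
   Formalization: The inclusion (x_n,x_n* )∈∂f_n is asserted only for n with f_n not identically +∞, and axiom (A1), inconsistent as written, is required only at points of dom f and weakened: ∂f(x) contains all global subgradients and consists of local ones. *)

theory Defs
  imports "HOL-Analysis.Analysis"
begin

section \<open>Lower semicontinuous functions, slope, Frechet subdifferential\<close>

text \<open>
  Extended-real-valued functions on a space with topology \<open>T\<close>.  Functions are normalised to be
  \<open>\<infinity>\<close> off the space, which only matters for spaces whose point set is not a whole type.
\<close>

definition LSC :: "'a topology \<Rightarrow> ('a \<Rightarrow> ereal) set" where
  "LSC T = {f. (\<forall>a::real. openin T {x \<in> topspace T. ereal a < f x}) \<and>
               (\<forall>x \<in> topspace T. f x \<noteq> -\<infinity>) \<and> (\<forall>x. x \<notin> topspace T \<longrightarrow> f x = \<infinity>)}"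

definition domain :: "('a \<Rightarrow> ereal) \<Rightarrow> 'a set" where
  "domain f = {x. f x < \<infinity>}"

definition epigraph :: "('a \<Rightarrow> ereal) \<Rightarrow> ('a \<times> real) set" where
  "epigraph f = {(x, \<alpha>). f x \<le> ereal \<alpha>}"

definition finite_graph :: "('a \<Rightarrow> ereal) \<Rightarrow> ('a \<times> real) set" where
  "finite_graph f = {(x, \<alpha>). f x = ereal \<alpha>}"

definition delta :: "'a set \<Rightarrow> 'a \<Rightarrow> ereal" where
  "delta S x = (if x \<in> S then 0 else \<infinity>)"

text \<open>
  The outer \<open>max 0\<close> changes the value only in the zero space, where \<open>at x\<close> is the
  trivial filter and the upper limit would be \<open>-\<infinity>\<close> rather than \<open>0\<close>.
\<close>

definition slope :: "('a::real_normed_vector \<Rightarrow> ereal) \<Rightarrow> 'a \<Rightarrow> ereal" where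
  "slope f x = max 0 (Limsup (at x) (\<lambda>y. max 0 (f x - f y) / ereal (norm (x - y))))"

definition frechet_subdiff ::
    "('a::real_normed_vector \<Rightarrow> ereal) \<Rightarrow> ('a \<times> ('a \<Rightarrow>\<^sub>L real)) set" where
  "frechet_subdiff f = {(z, p). z \<in> domain f \<and>
     0 \<le> Liminf (at z) (\<lambda>x. (f x - f z - ereal (blinfun_apply p (x - z))) / ereal (norm (x - z)))}"

definition convex_lipschitz :: "('a::real_normed_vector \<Rightarrow> real) \<Rightarrow> bool" where
  "convex_lipschitz \<phi> \<longleftrightarrow> convex_on UNIV \<phi> \<and> (\<exists>L. L-lipschitz_on UNIV \<phi>)"


section \<open>Slice convergence\<close>

definition continuous_affine :: "('a::real_normed_vector \<Rightarrow> real) \<Rightarrow> bool" where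
  "continuous_affine \<phi> \<longleftrightarrow> (\<exists>l c. bounded_linear l \<and> \<phi> = (\<lambda>x. l x + c))"

text \<open>
  The gap is taken for the max norm on the product with \<open>\<real>\<close>; the norm of the product type in the
  library is the Euclidean one.
\<close>

definition gap :: "('a::real_normed_vector \<times> real) set \<Rightarrow> ('a \<times> real) set \<Rightarrow> ereal" where
  "gap A B = (INF (x, \<alpha>) \<in> A. INF (y, \<beta>) \<in> B. ereal (max (norm (x - y)) \<bar>\<alpha> - \<beta>\<bar>))"

definition restrict_cball ::
    "('a::real_normed_vector \<Rightarrow> real) \<Rightarrow> 'a \<Rightarrow> real \<Rightarrow> 'a \<Rightarrow> ereal" where
  "restrict_cball \<phi> x \<mu> = (\<lambda>y. ereal (\<phi> y) + delta (cball x \<mu>) y)"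

definition slice_convergent ::
    "(nat \<Rightarrow> 'a::real_normed_vector \<Rightarrow> ereal) \<Rightarrow> ('a \<Rightarrow> ereal) \<Rightarrow> bool" where
  "slice_convergent g f \<longleftrightarrow>
     (\<forall>x \<phi> r. continuous_affine \<phi> \<and> 0 \<le> r \<longrightarrow>
        (\<exists>xs. xs \<longlonglongrightarrow> x \<and> (\<lambda>n. g n (xs n)) \<longlonglongrightarrow> f x) \<and>
        (0 < gap (finite_graph (restrict_cball \<phi> x r)) (epigraph f) \<longrightarrow>
         0 < (SUP \<delta> \<in> {0<..}. liminf (\<lambda>n.
                gap (finite_graph (restrict_cball \<phi> x (r + \<delta>))) (epigraph (g n))))))"


section \<open>Banach spaces as objects\<close>

text \<open>
  A subdifferential acts on all Banach spaces at once, so here Banach spaces are values: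
  a point set inside the type \<open>'a\<close> together with operations.  Values of the operations off
  the point set are irrelevant.
\<close>

record 'a nspace =
  pts :: "'a set"
  nzero :: 'a
  nadd :: "'a \<Rightarrow> 'a \<Rightarrow> 'a"
  nscale :: "real \<Rightarrow> 'a \<Rightarrow> 'a"
  nnorm :: "'a \<Rightarrow> real"

definition ndist :: "'a nspace \<Rightarrow> 'a \<Rightarrow> 'a \<Rightarrow> real" where
  "ndist X x y = (if x \<in> pts X \<and> y \<in> pts X then nnorm X (nadd X x (nscale X (-1) y)) else 0)"

definition ntop :: "'a nspace \<Rightarrow> 'a topology" where
  "ntop X = Metric_space.mtopology (pts X) (ndist X)"

definition banach_space :: "'a nspace \<Rightarrow> bool" where
  "banach_space X \<longleftrightarrow>
     nzero X \<in> pts X \<and>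
     (\<forall>x \<in> pts X. \<forall>y \<in> pts X. nadd X x y \<in> pts X) \<and>
     (\<forall>a. \<forall>x \<in> pts X. nscale X a x \<in> pts X) \<and>
     (\<forall>x \<in> pts X. \<forall>y \<in> pts X. \<forall>z \<in> pts X. nadd X (nadd X x y) z = nadd X x (nadd X y z)) \<and>
     (\<forall>x \<in> pts X. \<forall>y \<in> pts X. nadd X x y = nadd X y x) \<and>
     (\<forall>x \<in> pts X. nadd X (nzero X) x = x) \<and>
     (\<forall>x \<in> pts X. \<exists>y \<in> pts X. nadd X x y = nzero X) \<and>
     (\<forall>a. \<forall>x \<in> pts X. \<forall>y \<in> pts X.
        nscale X a (nadd X x y) = nadd X (nscale X a x) (nscale X a y)) \<and>
     (\<forall>a b. \<forall>x \<in> pts X. nscale X (a + b) x = nadd X (nscale X a x) (nscale X b x)) \<and>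
     (\<forall>a b. \<forall>x \<in> pts X. nscale X a (nscale X b x) = nscale X (a * b) x) \<and>
     (\<forall>x \<in> pts X. nscale X 1 x = x) \<and>
     (\<forall>x \<in> pts X. 0 \<le> nnorm X x \<and> (nnorm X x = 0 \<longleftrightarrow> x = nzero X)) \<and>
     (\<forall>a. \<forall>x \<in> pts X. nnorm X (nscale X a x) = \<bar>a\<bar> * nnorm X x) \<and>
     (\<forall>x \<in> pts X. \<forall>y \<in> pts X. nnorm X (nadd X x y) \<le> nnorm X x + nnorm X y) \<and>
     Metric_space.mcomplete (pts X) (ndist X)"

text \<open>Continuous linear functionals, normalised to be \<open>0\<close> off the space.\<close>

definition ndual :: "'a nspace \<Rightarrow> ('a \<Rightarrow> real) set" where
  "ndual X = {p.
     (\<forall>x \<in> pts X. \<forall>y \<in> pts X. p (nadd X x y) = p x + p y) \<and>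
     (\<forall>a. \<forall>x \<in> pts X. p (nscale X a x) = a * p x) \<and>
     (\<exists>C. \<forall>x \<in> pts X. \<bar>p x\<bar> \<le> C * nnorm X x) \<and>
     (\<forall>x. x \<notin> pts X \<longrightarrow> p x = 0)}"

definition convex_near :: "'a nspace \<Rightarrow> ('a \<Rightarrow> ereal) \<Rightarrow> 'a \<Rightarrow> bool" where
  "convex_near X f x \<longleftrightarrow> (\<exists>r>0. \<forall>u \<in> pts X. \<forall>v \<in> pts X. \<forall>t.
     ndist X x u < r \<and> ndist X x v < r \<and> 0 < t \<and> t < 1 \<longrightarrow>
     f (nadd X (nscale X (1 - t) u) (nscale X t v)) \<le> ereal (1 - t) * f u + ereal t * f v)"

text \<open>
  The product of two spaces must again have its points in \<open>'a\<close>, so ordered pairs are coded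
  by an injection \<open>pair\<close>.  The product carries the max norm.
\<close>

definition nprod :: "('a \<times> 'a \<Rightarrow> 'a) \<Rightarrow> 'a nspace \<Rightarrow> 'a nspace \<Rightarrow> 'a nspace" where
  "nprod pair X Y = (let l = (\<lambda>z. fst (inv pair z)); r = (\<lambda>z. snd (inv pair z)) in
     \<lparr>pts = pair ` (pts X \<times> pts Y),
      nzero = pair (nzero X, nzero Y),
      nadd = (\<lambda>z w. pair (nadd X (l z) (l w), nadd Y (r z) (r w))),
      nscale = (\<lambda>a z. pair (nscale X a (l z), nscale Y a (r z))),
      nnorm = (\<lambda>z. max (nnorm X (l z)) (nnorm Y (r z)))\<rparr>)"

definition whole_space :: "'a::banach nspace" where
  "whole_space = \<lparr>pts = UNIV, nzero = 0, nadd = (+), nscale = scaleR, nnorm = norm\<rparr>"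

lemma pts_whole_space: "pts whole_space = UNIV"
  by (simp add: whole_space_def)

lemma ndist_whole_space: "ndist whole_space = (dist :: 'a::banach \<Rightarrow> 'a \<Rightarrow> real)"
  by (auto simp: ndist_def whole_space_def dist_norm fun_eq_iff)

lemma ntop_whole_space: "ntop whole_space = (euclidean :: 'a::banach topology)"
  by (simp add: ntop_def ndist_whole_space pts_whole_space)

lemma banach_space_whole_space: "banach_space (whole_space :: 'a::banach nspace)"
proof -
  have c: "Metric_space.mcomplete (UNIV::'a set) dist"
    by (simp add: mcomplete_iff_complete complete_UNIV)
  have e: "\<exists>y. x + y = 0" for x :: 'a by (rule exI[of _ "-x"]) simp
  show ?thesis unfolding banach_space_def ndist_whole_space pts_whole_space
    using c e by (auto simp: whole_space_def algebra_simps norm_triangle_ineq)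
qed

lemma ndual_whole_space: "ndual (whole_space :: 'a::banach nspace) = range blinfun_apply"
proof -
  have "ndual (whole_space :: 'a::banach nspace) = {l. bounded_linear l}"
    unfolding ndual_def whole_space_def
    by (auto simp: bounded_linear_def linear_iff bounded_linear_axioms_def mult.commute)
  also have "\<dots> = range blinfun_apply"
    by (rule type_definition.Rep_range[OF type_definition_blinfun, symmetric])
  finally show ?thesis .
qed

lemma ex_inj_pair: "\<exists>pair :: 'a::real_vector \<times> 'a \<Rightarrow> 'a. inj pair"
proof (cases "\<exists>v::'a. v \<noteq> 0")
  case True
  then obtain v :: 'a where "v \<noteq> 0" by blast
  then have "inj (\<lambda>a::real. a *\<^sub>R v)" by (auto intro: injI)
  then have "infinite (UNIV :: 'a set)"
    by (metis finite_subset finite_imageD infinite_UNIV_char_0 top_greatest)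
  then have "(UNIV :: 'a set) \<times> (UNIV :: 'a set) \<approx> (UNIV :: 'a set)"
    using card_of_Times_same_infinite eqpoll_iff_card_of_ordIso by blast
  then show ?thesis by (auto simp: eqpoll_def bij_betw_def)
next
  case False
  then have "inj (fst :: 'a \<times> 'a \<Rightarrow> 'a)" by (metis injI prod_eqI)
  then show ?thesis by blast
qed


section \<open>Subdifferentials\<close>

text \<open>
  \<open>D X f x\<close> is the subdifferential of \<open>f\<close> at \<open>x\<close> in the space \<open>X\<close>; nothing is assumed about its
  value unless \<open>X\<close> is a Banach space, \<open>f\<close> is lower semicontinuous on \<open>X\<close> and \<open>x\<close> is a point of \<open>X\<close>.

  \<open>subdiff_convex\<close>: for \<open>f\<close> convex near a point \<open>x\<close> of its domain, \<open>D X f x\<close> lies between the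
  functionals satisfying the subgradient inequality on all of \<open>X\<close> and those satisfying it near \<open>x\<close>.
  The two sets agree for convex \<open>f\<close>.  If \<open>f\<close> is convex only near \<open>x\<close>, equality with the first set
  would contradict the slope control property below (the function that is \<open>0\<close> on the open unit ball
  and \<open>-1\<close> elsewhere would have no subgradient at any point of the ball), whereas usual
  subdifferentials satisfy equality with the second.  At points off the domain, equality
  would contradict \<open>subdiff_separable\<close> (take one summand identically \<open>\<infinity>\<close>).
\<close>

definition subgrad_global :: "'a nspace \<Rightarrow> ('a \<Rightarrow> ereal) \<Rightarrow> 'a \<Rightarrow> ('a \<Rightarrow> real) set" where
  "subgrad_global X f x = {p \<in> ndual X. \<forall>y \<in> pts X. ereal (p y - p x) + f x \<le> f y}"

definition subgrad_local :: "'a nspace \<Rightarrow> ('a \<Rightarrow> ereal) \<Rightarrow> 'a \<Rightarrow> ('a \<Rightarrow> real) set" where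
  "subgrad_local X f x =
     {p \<in> ndual X. \<exists>r>0. \<forall>y \<in> pts X. ndist X x y < r \<longrightarrow> ereal (p y - p x) + f x \<le> f y}"

type_synonym 'a subdiff_op = "'a nspace \<Rightarrow> ('a \<Rightarrow> ereal) \<Rightarrow> 'a \<Rightarrow> ('a \<Rightarrow> real) set"

definition subdiff_convex :: "'a subdiff_op \<Rightarrow> bool" where
  "subdiff_convex D \<longleftrightarrow>
     (\<forall>X f x. banach_space X \<and> f \<in> LSC (ntop X) \<and> x \<in> pts X \<and> x \<in> domain f \<and> convex_near X f x \<longrightarrow>
        subgrad_global X f x \<subseteq> D X f x \<and> D X f x \<subseteq> subgrad_local X f x)"

definition subdiff_separable :: "('a \<times> 'a \<Rightarrow> 'a) \<Rightarrow> 'a subdiff_op \<Rightarrow> bool" where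
  "subdiff_separable pair D \<longleftrightarrow>
     (\<forall>X Y f g F. banach_space X \<and> banach_space Y \<and> f \<in> LSC (ntop X) \<and> g \<in> LSC (ntop Y) \<and>
        F \<in> LSC (ntop (nprod pair X Y)) \<and>
        (\<forall>x \<in> pts X. \<forall>y \<in> pts Y. F (pair (x, y)) = f x + g y) \<longrightarrow>
        (\<forall>x \<in> pts X. \<forall>y \<in> pts Y. \<forall>q \<in> D (nprod pair X Y) F (pair (x, y)).
           \<exists>p1 \<in> D X f x. \<exists>p2 \<in> D Y g y.
             \<forall>u \<in> pts X. \<forall>v \<in> pts Y. q (pair (u, v)) = p1 u + p2 v))"

definition subdiff_translate :: "'a subdiff_op \<Rightarrow> bool" where
  "subdiff_translate D \<longleftrightarrow>
     (\<forall>X f p x. banach_space X \<and> f \<in> LSC (ntop X) \<and> p \<in> ndual X \<and> x \<in> pts X \<longrightarrow>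
        D X (\<lambda>y. f y + ereal (p y)) x = (\<lambda>q y. q y + p y) ` D X f x)"

definition is_subdifferential :: "('a \<times> 'a \<Rightarrow> 'a) \<Rightarrow> 'a subdiff_op \<Rightarrow> bool" where
  "is_subdifferential pair D \<longleftrightarrow>
     (\<forall>X f x. banach_space X \<and> f \<in> LSC (ntop X) \<and> x \<in> pts X \<longrightarrow> D X f x \<subseteq> ndual X) \<and>
     subdiff_convex D \<and> subdiff_separable pair D \<and> subdiff_translate D"

text \<open>The graph of the subdifferential of a function defined on the whole Banach space \<open>'a\<close>.\<close>

definition subdiff_graph ::
    "'a::banach subdiff_op \<Rightarrow> ('a \<Rightarrow> ereal) \<Rightarrow> ('a \<times> ('a \<Rightarrow>\<^sub>L real)) set" where
  "subdiff_graph D f = {(x, p). blinfun_apply p \<in> D whole_space f x}"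

definition slope_control :: "'a::banach subdiff_op \<Rightarrow> bool" where
  "slope_control D \<longleftrightarrow>
     (\<forall>f \<phi> z. f \<in> LSC euclidean \<and> convex_lipschitz \<phi> \<and> z \<in> domain f \<longrightarrow>
        (\<exists>xs ps ys qs.
           (\<forall>n. (xs n, ps n) \<in> subdiff_graph D f) \<and>
           (\<forall>n. (ys n, qs n) \<in> subdiff_graph D (\<lambda>y. ereal (\<phi> y))) \<and>
           xs \<longlonglongrightarrow> z \<and> (\<lambda>n. f (xs n)) \<longlonglongrightarrow> f z \<and> ys \<longlonglongrightarrow> z \<and>
           limsup (\<lambda>n. ereal (norm (ps n + qs n))) \<le> slope (\<lambda>x. f x + ereal (\<phi> x)) z))"

end

theory Submission
  imports Defs
begin

text \<open>
  Write \<open>g\<^sub>n = f\<^sub>n + \<phi>\<^sub>n\<close>.  A Frechet subgradient \<open>p\<close> of \<open>f\<close> at \<open>z\<close> makes \<open>z\<close> an almost minimizer of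
  \<open>f - p\<close> on every small ball: the loss on a ball of radius \<open>r\<close> is only a small multiple of \<open>r\<close>.
  Both halves of slice convergence carry this over to \<open>g\<^sub>n\<close>.  The condition on gaps turns an affine
  minorant of \<open>f\<close> with linear part \<open>p\<close> into one of \<open>g\<^sub>n\<close> on a slightly smaller ball, for all large \<open>n\<close>
  (\<open>slice_convergent_minorant\<close>), and the recovery sequence supplies points \<open>v\<^sub>n\<close> near \<open>z\<close> at which
  \<open>g\<^sub>n - p\<close> exceeds that lower bound by at most a small multiple of \<open>r\<close>.

  Ekeland's principle then moves \<open>v\<^sub>n\<close> by less than the radius to a point \<open>u\<^sub>n\<close> where \<open>g\<^sub>n - p\<close> has
  small slope (\<open>small_slope_near_almost_minimizer\<close>).  Since \<open>\<phi>\<^sub>n - p\<close> is again convex and Lipschitz,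
  slope control applies to \<open>f\<^sub>n\<close> and \<open>\<phi>\<^sub>n - p\<close> at \<open>u\<^sub>n\<close>; translating the subgradients of \<open>\<phi>\<^sub>n - p\<close>
  back by \<open>p\<close> gives the required pairs up to a prescribed error (\<open>slope_control_tilted\<close>).  A diagonal
  choice lets the error tend to \<open>0\<close>.
\<close>

section \<open>Ekeland's variational principle\<close>

text \<open>
  The set \<open>S x\<close> in the proof consists of the points reachable from \<open>x\<close> by decreasing \<open>F\<close> at rate at
  least \<open>\<sigma>\<close>.  Descending repeatedly to an almost minimizer of \<open>F\<close> on the current \<open>S x\<close> produces a
  Cauchy sequence, and nothing but its limit is reachable from the limit.  Closedness is required of
  the sublevel sets only, so that \<open>A\<close> may be the domain of an extended-real-valued lower
  semicontinuous function.
\<close>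

lemma ekeland_variational_principle:
  fixes F :: "'a::complete_space \<Rightarrow> real"
  assumes closed_sublevel: "\<And>a. closed {x \<in> A. F x \<le> a}"
    and lower: "\<And>x. x \<in> A \<Longrightarrow> m \<le> F x"
    and "x0 \<in> A" and "0 < \<sigma>"
  obtains u where "u \<in> A" "F u + \<sigma> * dist x0 u \<le> F x0"
    "\<And>y. y \<in> A \<Longrightarrow> y \<noteq> u \<Longrightarrow> F u < F y + \<sigma> * dist u y"
proof -
  define S where "S x = {y \<in> A. F y + \<sigma> * dist x y \<le> F x}" for x
  have S_trans: "S y \<subseteq> S x" if "y \<in> S x" for x y
  proof
    fix w assume "w \<in> S y"
    moreover have "\<sigma> * dist x w \<le> \<sigma> * dist x y + \<sigma> * dist y w"
      using \<open>0 < \<sigma>\<close> dist_triangle[of x w y] by (simp flip: distrib_left)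
    ultimately show "w \<in> S x" using that unfolding S_def by auto
  qed
  have S_refl: "x \<in> S x" if "x \<in> A" for x
    using that by (simp add: S_def)
  have "\<exists>w \<in> S x. \<forall>y \<in> S x. F w \<le> F y + (1/2) ^ n" if x: "x \<in> A" for x and n :: nat
  proof -
    have bdd: "bdd_below (F ` S x)"
      using lower by (intro bdd_belowI[of _ m]) (auto simp: S_def)
    obtain w where "w \<in> S x" "F w < Inf (F ` S x) + (1/2) ^ n"
      using cInf_lessD[of "F ` S x" "Inf (F ` S x) + (1/2) ^ n"] S_refl[OF x] by auto
    moreover have "Inf (F ` S x) \<le> F y" if "y \<in> S x" for y
      using that by (intro cInf_lower bdd imageI)
    ultimately show ?thesis by (intro bexI[of _ w] ballI) fastforce+
  qed
  then have "\<forall>x n. \<exists>w. x \<in> A \<longrightarrow> w \<in> S x \<and> (\<forall>y \<in> S x. F w \<le> F y + (1/2) ^ n)"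
    by blast
  then obtain nxt where nxt: "\<And>x n. x \<in> A \<Longrightarrow> nxt x n \<in> S x"
      "\<And>x n y. x \<in> A \<Longrightarrow> y \<in> S x \<Longrightarrow> F (nxt x n) \<le> F y + (1/2) ^ n"
    by metis
  define xs where "xs = rec_nat x0 (\<lambda>n x. nxt x n)"
  have xs_0: "xs 0 = x0" and xs_Suc: "\<And>n. xs (Suc n) = nxt (xs n) n"
    by (simp_all add: xs_def)
  have in_A: "xs n \<in> A" for n
    by (induction n) (use \<open>x0 \<in> A\<close> nxt(1) in \<open>auto simp: xs_0 xs_Suc S_def\<close>)
  have in_S: "xs n \<in> S (xs k)" if "k \<le> n" for k n
    using that
  proof (induction rule: dec_induct)
    case base
    show ?case by (rule S_refl[OF in_A])
  next
    case (step j)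
    have "xs (Suc j) \<in> S (xs j)" using nxt(1)[OF in_A] by (simp add: xs_Suc)
    then show ?case using S_trans[OF step.IH] by blast
  qed
  have desc: "F (xs n) + \<sigma> * dist (xs k) (xs n) \<le> F (xs k)" if "k \<le> n" for k n
    using in_S[OF that] by (simp add: S_def)
  have "decseq (\<lambda>n. F (xs n))"
    unfolding decseq_def
  proof (intro allI impI)
    fix k n :: nat assume "k \<le> n"
    moreover have "0 \<le> \<sigma> * dist (xs k) (xs n)" using \<open>0 < \<sigma>\<close> by simp
    ultimately show "F (xs n) \<le> F (xs k)" using desc[of k n] by linarith
  qed
  then obtain L where L: "(\<lambda>n. F (xs n)) \<longlonglongrightarrow> L" "\<And>n. L \<le> F (xs n)"
    using decseq_convergent[of "\<lambda>n. F (xs n)" m] lower in_A by blast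
  have "Cauchy xs"
    unfolding Cauchy_altdef2
  proof (intro allI impI)
    fix e :: real assume "0 < e"
    then have "\<forall>\<^sub>F n in sequentially. F (xs n) < L + \<sigma> * e"
      using L(1) \<open>0 < \<sigma>\<close> by (intro order_tendstoD) auto
    then obtain N where N: "F (xs N) < L + \<sigma> * e"
      by (auto simp: eventually_sequentially)
    have "dist (xs n) (xs N) < e" if "N \<le> n" for n
    proof -
      have "\<sigma> * dist (xs N) (xs n) < \<sigma> * e"
        using desc[OF that] L(2)[of n] N by linarith
      then show ?thesis using \<open>0 < \<sigma>\<close> by (simp add: dist_commute)
    qed
    then show "\<exists>N. \<forall>n\<ge>N. dist (xs n) (xs N) < e" by blast
  qed
  then obtain u where u: "xs \<longlonglongrightarrow> u"
    using Cauchy_convergent convergent_def by blast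
  have sub: "u \<in> {x \<in> A. F x \<le> L + e}" if "0 < e" for e
  proof (rule Lim_in_closed_set[OF closed_sublevel _ _ u])
    have "\<forall>\<^sub>F n in sequentially. F (xs n) < L + e"
      using L(1) that by (intro order_tendstoD) auto
    then show "\<forall>\<^sub>F n in sequentially. xs n \<in> {x \<in> A. F x \<le> L + e}"
      by eventually_elim (simp add: in_A)
  qed simp
  have "u \<in> A" using sub[of 1] by simp
  have "F u \<le> L"
  proof (rule field_le_epsilon)
    fix e :: real assume "0 < e"
    then show "F u \<le> L + e" using sub[of e] by simp
  qed
  have u_in_S: "u \<in> S (xs k)" for k
  proof -
    have "L + \<sigma> * dist (xs k) u \<le> F (xs k)"
      by (rule LIMSEQ_le_const2[where X = "\<lambda>n. F (xs n) + \<sigma> * dist (xs k) (xs n)"])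
        (auto intro!: tendsto_intros L(1) u desc)
    then show ?thesis using \<open>F u \<le> L\<close> \<open>u \<in> A\<close> by (simp add: S_def)
  qed
  show thesis
  proof (rule that[of u])
    show "u \<in> A" by fact
    show "F u + \<sigma> * dist x0 u \<le> F x0"
      using u_in_S[of 0] by (simp add: S_def xs_0)
    fix y assume "y \<in> A" "y \<noteq> u"
    show "F u < F y + \<sigma> * dist u y"
    proof (rule ccontr)
      assume "\<not> ?thesis"
      with \<open>y \<in> A\<close> have "y \<in> S u" by (simp add: S_def)
      then have y: "y \<in> S (xs k)" for k using S_trans[OF u_in_S] by blast
      \<comment> \<open>The near-optimal choice of each step confines \<open>S (xs (Suc n))\<close> to a ball of vanishing radius.\<close>
      have "dist (xs (Suc n)) y \<le> (1/2) ^ n / \<sigma>" for n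
      proof -
        have "F (xs (Suc n)) \<le> F y + (1/2) ^ n"
          using nxt(2)[OF in_A y] by (simp add: xs_Suc)
        moreover have "F y + \<sigma> * dist (xs (Suc n)) y \<le> F (xs (Suc n))"
          using y[of "Suc n"] by (simp add: S_def)
        ultimately have "dist (xs (Suc n)) y * \<sigma> \<le> (1/2) ^ n"
          by (simp add: mult.commute)
        then show ?thesis
          using \<open>0 < \<sigma>\<close> by (simp only: pos_le_divide_eq)
      qed
      moreover have "(\<lambda>n. (1/2) ^ n / \<sigma>) \<longlonglongrightarrow> 0 / \<sigma>"
        by (intro tendsto_divide LIMSEQ_realpow_zero) (use \<open>0 < \<sigma>\<close> in auto)
      then have "(\<lambda>n. (1/2) ^ n / \<sigma>) \<longlonglongrightarrow> 0" by simp
      ultimately have "(\<lambda>n. dist (xs (Suc n)) y) \<longlonglongrightarrow> 0"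
        using Lim_null_comparison[of "\<lambda>n. dist (xs (Suc n)) y" "\<lambda>n. (1/2) ^ n / \<sigma>" sequentially]
        by simp
      then have "(\<lambda>n. xs (Suc n)) \<longlonglongrightarrow> y" by (subst tendsto_dist_iff)
      then have "xs \<longlonglongrightarrow> y" by (rule LIMSEQ_imp_Suc)
      then show False using u \<open>y \<noteq> u\<close> LIMSEQ_unique by blast
    qed
  qed
qed

section \<open>Points of small slope\<close>

lemma LSC_not_MInf: "f \<in> LSC euclidean \<Longrightarrow> f x \<noteq> -\<infinity>"
  by (simp add: LSC_def)

lemma LSC_finite:
  assumes "f \<in> LSC euclidean" "x \<in> domain f"
  shows "f x = ereal (real_of_ereal (f x))"
  using LSC_not_MInf[OF assms(1), of x] assms(2) by (cases "f x") (auto simp: domain_def)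

lemma closed_LSC_le_continuous:
  fixes f :: "'a::topological_space \<Rightarrow> ereal"
  assumes "f \<in> LSC euclidean" and "continuous_on UNIV c"
  shows "closed {x. f x \<le> ereal (c x)}"
proof -
  have "- {x. f x \<le> ereal (c x)} = (\<Union>b. {x. c x < b} \<inter> {x. ereal b < f x})"
  proof (intro set_eqI iffI)
    fix x assume "x \<in> - {x. f x \<le> ereal (c x)}"
    then obtain b where "ereal (c x) < ereal b" "ereal b < f x"
      using ereal_dense2[of "ereal (c x)" "f x"] by (auto simp: not_le)
    then show "x \<in> (\<Union>b. {x. c x < b} \<inter> {x. ereal b < f x})" by auto
  next
    fix x assume "x \<in> (\<Union>b. {x. c x < b} \<inter> {x. ereal b < f x})"
    then obtain b where "ereal (c x) < ereal b" "ereal b < f x" by auto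
    then have "ereal (c x) < f x" by (rule less_trans)
    then show "x \<in> - {x. f x \<le> ereal (c x)}" by simp
  qed
  moreover have "open {x. c x < b}" for b
    using assms(2) by (intro open_Collect_less continuous_intros)
  moreover have "open {x. ereal b < f x}" for b
  proof -
    have "openin euclidean {x \<in> topspace euclidean. ereal b < f x}"
      using assms(1) unfolding LSC_def by blast
    then show ?thesis by simp
  qed
  ultimately have "open (- {x. f x \<le> ereal (c x)})" by (simp add: open_UN open_Int)
  then show ?thesis by (simp only: closed_def)
qed

text \<open>
  Ekeland's principle for \<open>f + k\<close> on the ball: a point that minimizes up to \<open>\<eta>\<close> lies within \<open>\<eta> / \<sigma>\<close>
  of a strict minimizer \<open>u\<close> of \<open>f + k + \<sigma> dist u\<close>.  Strict minimality is a bound on the slope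
  because \<open>u\<close> stays in the open ball, so that the constraint is invisible near \<open>u\<close>.
\<close>

lemma small_slope_near_almost_minimizer:
  fixes f :: "'a::banach \<Rightarrow> ereal" and k :: "'a \<Rightarrow> real"
  assumes f: "f \<in> LSC euclidean" and k: "continuous_on UNIV k" and "0 < \<sigma>" and "0 \<le> \<eta>"
    and lower: "\<And>x. x \<in> cball z r \<Longrightarrow> ereal m \<le> f x + ereal (k x)"
    and x0: "f x0 + ereal (k x0) \<le> ereal (m + \<eta>)" and near: "dist z x0 + \<eta> / \<sigma> < r"
  obtains u where "u \<in> ball z r" "u \<in> domain f" "f u + ereal (k u) \<le> f x0 + ereal (k x0)"
    "slope (\<lambda>x. f x + ereal (k x)) u \<le> ereal \<sigma>"
proof -
  define A where "A = cball z r \<inter> domain f"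
  define F where "F x = real_of_ereal (f x) + k x" for x
  have F: "f x + ereal (k x) = ereal (F x)" if "x \<in> domain f" for x
    using LSC_finite[OF f that] unfolding F_def by (metis plus_ereal.simps(1))
  have x0_dom: "x0 \<in> domain f"
    using x0 by (cases "f x0") (auto simp: domain_def)
  have "closed {x \<in> A. F x \<le> a}" for a
  proof -
    have "{x \<in> A. F x \<le> a} = cball z r \<inter> {x. f x \<le> ereal (a - k x)}"
    proof (intro set_eqI)
      fix x
      show "x \<in> {x \<in> A. F x \<le> a} \<longleftrightarrow> x \<in> cball z r \<inter> {x. f x \<le> ereal (a - k x)}"
        using LSC_not_MInf[OF f, of x]
        by (cases "f x") (auto simp: A_def F_def domain_def)
    qed
    moreover have "closed {x. f x \<le> ereal (a - k x)}"
      using k by (intro closed_LSC_le_continuous f continuous_intros)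
    ultimately show ?thesis by (simp add: closed_Int)
  qed
  moreover have mF: "m \<le> F x" if "x \<in> A" for x
    using lower[of x] F[of x] that by (auto simp: A_def)
  moreover have "x0 \<in> A"
  proof -
    have "0 \<le> \<eta> / \<sigma>" using \<open>0 \<le> \<eta>\<close> \<open>0 < \<sigma>\<close> by simp
    then show ?thesis using near x0_dom by (simp add: A_def)
  qed
  ultimately obtain u where u: "u \<in> A" "F u + \<sigma> * dist x0 u \<le> F x0"
    "\<And>y. y \<in> A \<Longrightarrow> y \<noteq> u \<Longrightarrow> F u < F y + \<sigma> * dist u y"
    using ekeland_variational_principle[of A F m x0 \<sigma>] \<open>0 < \<sigma>\<close> by blast
  have u_dom: "u \<in> domain f" using u(1) by (simp add: A_def)
  have "\<sigma> * dist x0 u \<le> \<eta>"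
    using u(2) mF[OF u(1)] x0 F[OF x0_dom] by simp
  then have "dist x0 u \<le> \<eta> / \<sigma>"
    using \<open>0 < \<sigma>\<close> by (simp add: field_simps)
  then have u_ball: "u \<in> ball z r"
    using near dist_triangle[of z u x0] by simp
  have quotient: "max 0 (f u + ereal (k u) - (f y + ereal (k y))) / ereal (norm (u - y)) \<le> ereal \<sigma>"
    if "y \<noteq> u" "y \<in> ball z r" for y
  proof (cases "y \<in> domain f")
    case True
    then have "F u < F y + \<sigma> * dist u y" using u(3)[of y] that by (simp add: A_def)
    moreover have "0 \<le> \<sigma> * dist u y" using \<open>0 < \<sigma>\<close> by simp
    ultimately have "max 0 (F u - F y) \<le> \<sigma> * norm (u - y)"
      by (simp add: dist_norm)
    then have "max 0 (F u - F y) / norm (u - y) \<le> \<sigma>"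
      using that(1) by (simp add: field_simps)
    then show ?thesis
      using that(1) by (simp add: F[OF u_dom] F[OF True] zero_ereal_def del: ereal_max flip: ereal_max)
  next
    case False
    then have "f y = \<infinity>" by (simp add: domain_def)
    then have "f u + ereal (k u) - (f y + ereal (k y)) = -\<infinity>" by (simp add: F[OF u_dom])
    then show ?thesis using \<open>0 < \<sigma>\<close> by simp
  qed
  have "\<forall>\<^sub>F y in at u. y \<in> ball z r"
    using eventually_at_topological open_ball u_ball by blast
  then have "\<forall>\<^sub>F y in at u.
      max 0 (f u + ereal (k u) - (f y + ereal (k y))) / ereal (norm (u - y)) \<le> ereal \<sigma>"
    using eventually_neq_at_within[of u u UNIV] by eventually_elim (rule quotient)
  then have "slope (\<lambda>x. f x + ereal (k x)) u \<le> ereal \<sigma>"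
    using \<open>0 < \<sigma>\<close> by (simp add: slope_def Limsup_bounded)
  moreover have "f u + ereal (k u) \<le> f x0 + ereal (k x0)"
  proof -
    have "0 \<le> \<sigma> * dist x0 u" using \<open>0 < \<sigma>\<close> by simp
    then show ?thesis using u(2) by (simp add: F u_dom x0_dom)
  qed
  ultimately show thesis using that u_ball u_dom by blast
qed

section \<open>Affine minorants\<close>

lemma frechet_subdiff_local_minorant:
  fixes f :: "'a::real_normed_vector \<Rightarrow> ereal"
  assumes f: "f \<in> LSC euclidean" and sub: "(z, p) \<in> frechet_subdiff f" and "0 < \<epsilon>"
  obtains \<rho> where "0 < \<rho>"
    "\<And>x. x \<in> cball z \<rho> \<Longrightarrow>
      f z + ereal (blinfun_apply p (x - z) - \<epsilon> * norm (x - z)) \<le> f x"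
proof -
  have "z \<in> domain f" using sub by (simp add: frechet_subdiff_def)
  then obtain a where a: "f z = ereal a" using LSC_finite[OF f] by blast
  let ?q = "\<lambda>x. (f x - f z - ereal (blinfun_apply p (x - z))) / ereal (norm (x - z))"
  have "ereal (- \<epsilon>) < 0" using \<open>0 < \<epsilon>\<close> by simp
  also have "0 \<le> Liminf (at z) ?q" using sub by (simp add: frechet_subdiff_def)
  finally have "\<forall>\<^sub>F x in at z. ereal (- \<epsilon>) < ?q x" by (rule less_LiminfD)
  then obtain d where d: "0 < d" "\<And>x. x \<noteq> z \<Longrightarrow> dist x z < d \<Longrightarrow> ereal (- \<epsilon>) < ?q x"
    unfolding eventually_at by blast
  show thesis
  proof (rule that[of "d / 2"])
    show "0 < d / 2" using d(1) by simp
    fix x assume x: "x \<in> cball z (d / 2)"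
    show "f z + ereal (blinfun_apply p (x - z) - \<epsilon> * norm (x - z)) \<le> f x"
    proof (cases "x = z")
      case False
      then have "ereal (- \<epsilon>) < ?q x" using x d by (simp add: dist_commute)
      then show ?thesis
        using False LSC_not_MInf[OF f, of x] by (cases "f x") (auto simp: a field_simps)
    qed simp
  qed
qed

text \<open>
  The gap between a graph and an epigraph vanishes as soon as they meet, so the gap condition
  transfers strict affine minorization.  The margins \<open>R - r\<close> and \<open>c\<close> keep the graph of \<open>a\<close> over the
  smaller ball at positive distance from the epigraph of \<open>f\<close>.
\<close>

lemma slice_convergent_minorant:
  fixes a :: "'a::real_normed_vector \<Rightarrow> real"
  assumes slice: "slice_convergent g f" and affine: "continuous_affine a"
    and "0 \<le> r" "r < R" "0 < c"
    and minorant: "\<And>x. x \<in> cball z R \<Longrightarrow> ereal (a x + c) \<le> f x"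
  shows "\<forall>\<^sub>F n in sequentially. \<forall>x \<in> cball z r. ereal (a x) < g n x"
proof -
  obtain l b where l: "bounded_linear l" and a: "a = (\<lambda>x. l x + b)"
    using affine by (auto simp: continuous_affine_def)
  obtain K where "0 < K" and K: "\<And>x. norm (l x) \<le> norm x * K"
    using bounded_linear.pos_bounded[OF l] by blast
  have lip: "\<bar>a x - a y\<bar> \<le> K * norm (x - y)" for x y
    using K[of "x - y"] by (simp add: a linear_diff[OF bounded_linear.linear[OF l]] mult.commute)
  have in_graph: "(x, \<alpha>) \<in> finite_graph (restrict_cball a z \<mu>) \<longleftrightarrow> x \<in> cball z \<mu> \<and> \<alpha> = a x"
    for x \<alpha> \<mu>
    by (auto simp: finite_graph_def restrict_cball_def delta_def)
  \<comment> \<open>\<open>a\<close> is \<open>K\<close>-Lipschitz: moving by \<open>s\<close> in the space costs \<open>K * s\<close> in height, and a further \<open>s\<close> is the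
      vertical distance to be excluded.\<close>
  define s where "s = min (R - r) (c / (1 + K))"
  have "0 < s" using \<open>r < R\<close> \<open>0 < c\<close> \<open>0 < K\<close> by (simp add: s_def)
  have "s \<le> c / (1 + K)" by (simp add: s_def)
  then have s_c: "s * (1 + K) \<le> c"
    using \<open>0 < K\<close> by (simp add: pos_le_divide_eq)
  have "s \<le> max (norm (x - y)) \<bar>a x - \<beta>\<bar>" if x: "x \<in> cball z r" and y: "f y \<le> ereal \<beta>" for x y \<beta>
  proof (rule ccontr)
    assume "\<not> ?thesis"
    then have xy: "norm (x - y) < s" "\<bar>a x - \<beta>\<bar> < s" by auto
    have "dist z y \<le> dist z x + dist x y" by (rule dist_triangle)
    then have "y \<in> cball z R" using x xy(1) by (simp add: s_def dist_norm)
    from order_trans[OF minorant[OF this] y] have "a y + c \<le> \<beta>" by simp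
    moreover have "K * norm (x - y) < K * s" using xy(1) \<open>0 < K\<close> by simp
    ultimately show False using lip[of x y] xy(2) s_c by (simp add: algebra_simps)
  qed
  then have "ereal s \<le> gap (finite_graph (restrict_cball a z r)) (epigraph f)"
    unfolding gap_def by (auto intro!: INF_greatest simp: in_graph epigraph_def simp del: ereal_max)
  then have "0 < gap (finite_graph (restrict_cball a z r)) (epigraph f)"
    using \<open>0 < s\<close> by (metis ereal_less(2) less_le_trans)
  then have "0 < (SUP \<delta> \<in> {0<..}. liminf (\<lambda>n.
      gap (finite_graph (restrict_cball a z (r + \<delta>))) (epigraph (g n))))"
    using slice affine \<open>0 \<le> r\<close> unfolding slice_convergent_def by blast
  then obtain \<delta> where "0 < \<delta>" and
    "0 < liminf (\<lambda>n. gap (finite_graph (restrict_cball a z (r + \<delta>))) (epigraph (g n)))"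
    by (auto simp: less_SUP_iff)
  then have "\<forall>\<^sub>F n in sequentially. 0 < gap (finite_graph (restrict_cball a z (r + \<delta>))) (epigraph (g n))"
    by (metis less_LiminfD)
  then show ?thesis
  proof eventually_elim
    case (elim n)
    show ?case
    proof (intro ballI, rule ccontr)
      fix x assume x: "x \<in> cball z r" "\<not> ereal (a x) < g n x"
      have "gap (finite_graph (restrict_cball a z (r + \<delta>))) (epigraph (g n))
          \<le> ereal (max (norm (x - x)) \<bar>a x - a x\<bar>)"
        unfolding gap_def
        by (rule INF_lower2[where i = "(x, a x)"])
          (use x \<open>0 < \<delta>\<close> in \<open>auto simp: in_graph epigraph_def not_less intro!: INF_lower2[where i = "(x, a x)"]\<close>)
      then show False using elim by (simp flip: zero_ereal_def)
    qed
  qed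
qed

section \<open>Approximate subgradients from slope control\<close>

text \<open>
  Slope control yields subgradients of \<open>\<phi> - p\<close>; the translation rule turns them into subgradients of
  \<open>\<phi>\<close> shifted by \<open>- p\<close>, which moves the estimate from \<open>0\<close> to \<open>p\<close>.  The open sets \<open>S\<close> and \<open>T\<close> encode
  closeness of the points and of the mixed value \<open>f x + \<phi> y\<close>, which is close to \<open>f u + \<phi> u\<close> because
  \<open>\<phi>\<close> is continuous.
\<close>

lemma slope_control_tilted:
  fixes f :: "'a::banach \<Rightarrow> ereal"
  assumes subdiff: "is_subdifferential pair D" and control: "slope_control D"
    and f: "f \<in> LSC euclidean" and \<phi>: "convex_lipschitz \<phi>" and u: "u \<in> domain f"
    and small: "slope (\<lambda>x. f x + ereal (\<phi> x - blinfun_apply p x)) u < ereal \<epsilon>"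
    and "open S" "u \<in> S" "open T" "f u + ereal (\<phi> u) \<in> T"
  obtains x q y s where "(x, q) \<in> subdiff_graph D f" "(y, s) \<in> subdiff_graph D (\<lambda>y. ereal (\<phi> y))"
    "x \<in> S" "y \<in> S" "f x + ereal (\<phi> y) \<in> T" "norm (q + s - p) < \<epsilon>"
proof -
  let ?\<psi> = "\<lambda>x. \<phi> x - blinfun_apply p x"
  obtain L where L: "L-lipschitz_on UNIV \<phi>" and cvx: "convex_on UNIV \<phi>"
    using \<phi> by (auto simp: convex_lipschitz_def)
  have cont: "continuous_on UNIV \<phi>"
    using L by (rule lipschitz_on_continuous_on)
  have "convex_lipschitz ?\<psi>"
    unfolding convex_lipschitz_def
  proof
    have "convex_on UNIV (\<lambda>x. - blinfun_apply p x)"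
      by (rule convex_onI) (auto simp: blinfun.bilinear_simps algebra_simps)
    then have "convex_on UNIV (\<lambda>x. \<phi> x + - blinfun_apply p x)"
      by (rule convex_on_add[OF cvx])
    then show "convex_on UNIV ?\<psi>" by simp
    have "(norm p)-lipschitz_on UNIV (blinfun_apply p)"
    proof (rule lipschitz_onI)
      show "dist (blinfun_apply p x) (blinfun_apply p y) \<le> norm p * dist x y" for x y
        unfolding dist_norm using norm_blinfun[of p "x - y"] by (simp only: blinfun.diff_right)
    qed simp
    then show "\<exists>L. L-lipschitz_on UNIV ?\<psi>"
      using lipschitz_on_diff[OF L] by blast
  qed
  then obtain xs ps ys qs where
    xs: "\<And>n. (xs n, ps n) \<in> subdiff_graph D f" "xs \<longlonglongrightarrow> u" "(\<lambda>n. f (xs n)) \<longlonglongrightarrow> f u"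
    and ys: "\<And>n. (ys n, qs n) \<in> subdiff_graph D (\<lambda>y. ereal (?\<psi> y))" "ys \<longlonglongrightarrow> u"
    and ls: "limsup (\<lambda>n. ereal (norm (ps n + qs n))) \<le> slope (\<lambda>x. f x + ereal (?\<psi> x)) u"
    using control f u unfolding slope_control_def by blast
  have "limsup (\<lambda>n. ereal (norm (ps n + qs n))) < ereal \<epsilon>"
    using ls small by (rule le_less_trans)
  then have "\<forall>\<^sub>F n in sequentially. ereal (norm (ps n + qs n)) < ereal \<epsilon>"
    by (rule Limsup_lessD)
  moreover have "(\<lambda>n. \<phi> (ys n)) \<longlonglongrightarrow> \<phi> u"
    using continuous_on_tendsto_compose[OF cont ys(2)] by simp
  then have "(\<lambda>n. f (xs n) + ereal (\<phi> (ys n))) \<longlonglongrightarrow> f u + ereal (\<phi> u)"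
    using LSC_finite[OF f u] by (intro tendsto_add_ereal_general xs) auto
  then have "\<forall>\<^sub>F n in sequentially. f (xs n) + ereal (\<phi> (ys n)) \<in> T"
    using \<open>open T\<close> \<open>f u + ereal (\<phi> u) \<in> T\<close> by (rule topological_tendstoD)
  moreover have "\<forall>\<^sub>F n in sequentially. xs n \<in> S" "\<forall>\<^sub>F n in sequentially. ys n \<in> S"
    using xs(2) ys(2) \<open>open S\<close> \<open>u \<in> S\<close> by (auto dest: topological_tendstoD)
  ultimately have "\<forall>\<^sub>F n in sequentially. ereal (norm (ps n + qs n)) < ereal \<epsilon> \<and>
      f (xs n) + ereal (\<phi> (ys n)) \<in> T \<and> xs n \<in> S \<and> ys n \<in> S"
    by eventually_elim simp
  then obtain n where n: "norm (ps n + qs n) < \<epsilon>"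
      "f (xs n) + ereal (\<phi> (ys n)) \<in> T" "xs n \<in> S" "ys n \<in> S"
    by (auto simp: eventually_sequentially)
  have "(\<lambda>y. ereal (\<phi> y)) \<in> LSC (ntop whole_space)"
  proof -
    have "open {x. b < \<phi> x}" for b
      using cont by (intro open_Collect_less continuous_intros)
    then show ?thesis by (simp add: ntop_whole_space LSC_def flip: open_openin)
  qed
  moreover have "blinfun_apply (- p) \<in> ndual whole_space"
    by (simp add: ndual_whole_space)
  ultimately have pre: "banach_space (whole_space :: 'a nspace) \<and> (\<lambda>y. ereal (\<phi> y)) \<in> LSC (ntop whole_space) \<and>
      blinfun_apply (- p) \<in> ndual whole_space \<and> ys n \<in> pts whole_space"
    using banach_space_whole_space pts_whole_space by blast
  have "subdiff_translate D" using subdiff by (simp add: is_subdifferential_def)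
  then have "D whole_space (\<lambda>y. ereal (\<phi> y) + ereal (blinfun_apply (- p) y)) (ys n)
      = (\<lambda>q y. q y + blinfun_apply (- p) y) ` D whole_space (\<lambda>y. ereal (\<phi> y)) (ys n)"
    by (rule subdiff_translate_def[THEN iffD1, rule_format, OF _ pre])
  moreover have "blinfun_apply (qs n) \<in> D whole_space (\<lambda>y. ereal (?\<psi> y)) (ys n)"
    using ys(1)[of n] by (simp add: subdiff_graph_def)
  ultimately obtain q where q: "q \<in> D whole_space (\<lambda>y. ereal (\<phi> y)) (ys n)"
      "blinfun_apply (qs n) = (\<lambda>y. q y + blinfun_apply (- p) y)"
    by (auto simp: blinfun.minus_left)
  have "q = blinfun_apply (qs n + p)"
    by (auto simp: q(2) blinfun.bilinear_simps fun_eq_iff)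
  then have "(ys n, qs n + p) \<in> subdiff_graph D (\<lambda>y. ereal (\<phi> y))"
    using q(1) by (simp add: subdiff_graph_def)
  with n xs(1) show thesis
    by (intro that[of "xs n" "ps n" "ys n" "qs n + p"]) auto
qed

section \<open>Selection of the sequences\<close>

text \<open>
  At stage \<open>n\<close> the best error \<open>1 / Suc k\<close> with \<open>k \<le> n\<close> that can be attained is used; the bound on \<open>k\<close>
  makes a best one exist.
\<close>

lemma diagonal_choice:
  assumes fallback: "\<And>n. \<exists>w. S n w"
    and eventual: "\<And>\<epsilon>. 0 < \<epsilon> \<Longrightarrow> \<forall>\<^sub>F n in sequentially. \<exists>w. S n w \<and> P \<epsilon> n w"
    and mono: "\<And>\<epsilon> \<epsilon>' n w. \<epsilon> \<le> \<epsilon>' \<Longrightarrow> P \<epsilon> n w \<Longrightarrow> P \<epsilon>' n w"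
  shows "\<exists>w. (\<forall>n. S n (w n)) \<and> (\<forall>\<epsilon>::real. 0 < \<epsilon> \<longrightarrow> (\<forall>\<^sub>F n in sequentially. P \<epsilon> n (w n)))"
proof -
  define K where "K n = {k. k \<le> n \<and> (\<exists>w. S n w \<and> P (1 / Suc k) n w)}" for n
  have K_fin: "finite (K n)" for n
    by (simp add: K_def)
  have "\<exists>w. S n w \<and> (K n \<noteq> {} \<longrightarrow> P (1 / Suc (Max (K n))) n w)" for n
    using Max_in[OF K_fin, of n] fallback[of n] unfolding K_def by blast
  then obtain w where w: "\<And>n. S n (w n)" "\<And>n. K n \<noteq> {} \<Longrightarrow> P (1 / Suc (Max (K n))) n (w n)"
    by metis
  show ?thesis
  proof (intro exI[of _ w] conjI allI impI)
    show "S n (w n)" for n by (rule w(1))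
    fix \<epsilon> :: real assume "0 < \<epsilon>"
    then obtain k where k: "1 / Suc k < \<epsilon>"
      using nat_approx_posE by blast
    have "\<forall>\<^sub>F n in sequentially. \<exists>w. S n w \<and> P (1 / Suc k) n w"
      by (rule eventual) simp
    then show "\<forall>\<^sub>F n in sequentially. P \<epsilon> n (w n)"
      using eventually_ge_at_top[of k]
    proof eventually_elim
      case (elim n)
      then have "k \<in> K n" by (simp add: K_def)
      then have "k \<le> Max (K n)" "K n \<noteq> {}" using K_fin by auto
      then have "1 / real (Suc (Max (K n))) \<le> 1 / Suc k"
        by (intro divide_left_mono) auto
      then show ?case using w(2)[OF \<open>K n \<noteq> {}\<close>] k by (intro mono[of _ \<epsilon>]) auto
    qed
  qed
qed

section \<open>Stability of Frechet subgradients under slice convergence\<close>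

theorem theorem6p3:
  fixes pair :: "'a::banach \<times> 'a \<Rightarrow> 'a"
    and D :: "'a subdiff_op"
    and f :: "'a \<Rightarrow> ereal"
    and fs :: "nat \<Rightarrow> 'a \<Rightarrow> ereal"
    and \<phi>s :: "nat \<Rightarrow> 'a \<Rightarrow> real"
    and z :: 'a and p :: "'a \<Rightarrow>\<^sub>L real"
  assumes "inj pair"
    and "is_subdifferential pair D"
    and "slope_control D"
    and "\<And>n. fs n \<in> LSC euclidean"
    and "\<And>n. convex_lipschitz (\<phi>s n)"
    and "f \<in> LSC euclidean"
    and "slice_convergent (\<lambda>n x. fs n x + ereal (\<phi>s n x)) f"
    and "(z, p) \<in> frechet_subdiff f"
  shows "\<exists>xs ps ys qs.
           (\<forall>n. domain (fs n) \<noteq> {} \<longrightarrow> (xs n, ps n) \<in> subdiff_graph D (fs n)) \<and>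
           (\<forall>n. (ys n, qs n) \<in> subdiff_graph D (\<lambda>y. ereal (\<phi>s n y))) \<and>
           xs \<longlonglongrightarrow> z \<and> ys \<longlonglongrightarrow> z \<and>
           (\<lambda>n. fs n (xs n) + ereal (\<phi>s n (ys n))) \<longlonglongrightarrow> f z \<and>
           (\<lambda>n. ps n + qs n) \<longlonglongrightarrow> p"
proof -
  have "z \<in> domain f" using assms(8) by (simp add: frechet_subdiff_def)
  then obtain fz where fz: "f z = ereal fz" using LSC_finite[OF assms(6)] by blast
  let ?g = "\<lambda>n x. fs n x + ereal (\<phi>s n x)"
  have "\<exists>xs. xs \<longlonglongrightarrow> z \<and> (\<lambda>n. ?g n (xs n)) \<longlonglongrightarrow> f z"
  proof -
    have "continuous_affine (\<lambda>_::'a. 0)"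
      unfolding continuous_affine_def by (intro exI[of _ "\<lambda>_. 0"] exI[of _ 0]) simp
    then have "continuous_affine (\<lambda>_::'a. 0) \<and> (0::real) \<le> 0" by simp
    from slice_convergent_def[THEN iffD1, rule_format, OF assms(7) this]
    show ?thesis by (rule conjunct1)
  qed
  then obtain vs where vs: "vs \<longlonglongrightarrow> z" "(\<lambda>n. ?g n (vs n)) \<longlonglongrightarrow> ereal fz"
    by (auto simp: fz)
  \<comment> \<open>A candidate at stage \<open>n\<close> is a quadruple \<open>(x, q, y, s)\<close>; \<open>S\<close> collects the exact requirements, \<open>P \<epsilon>\<close>
      the approximate ones.  The error in the value is stated in \<open>ereal\<close> since \<open>fs n x\<close> may be infinite.\<close>
  define S where "S n = (\<lambda>(x, q, y, s). (domain (fs n) \<noteq> {} \<longrightarrow> (x, q) \<in> subdiff_graph D (fs n)) \<and>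
      (y, s) \<in> subdiff_graph D (\<lambda>y. ereal (\<phi>s n y)))" for n
  define P where "P \<epsilon> n = (\<lambda>(x, q, y, s). dist x z < \<epsilon> \<and> dist y z < \<epsilon> \<and>
      ereal (fz - \<epsilon>) < fs n x + ereal (\<phi>s n y) \<and> fs n x + ereal (\<phi>s n y) < ereal (fz + \<epsilon>) \<and>
      norm (q + s - p) < \<epsilon>)" for \<epsilon> n
  have fallback: "\<exists>w. S n w" for n
  proof -
    \<comment> \<open>Slope control with zero first summand shows that \<open>\<phi>s n\<close> has a subgradient somewhere, which
        also covers stages where \<open>fs n\<close> is identically \<open>\<infinity>\<close>.\<close>
    have "(\<lambda>_. 0) \<in> LSC (euclidean :: 'a topology)"
      unfolding LSC_def by (auto simp: zero_ereal_def)
    moreover have "0 \<in> domain (\<lambda>_::'a. 0::ereal)" by (simp add: domain_def)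
    ultimately obtain y s where ys: "(y, s) \<in> subdiff_graph D (\<lambda>y. ereal (\<phi>s n y))"
      using assms(3) assms(5)[of n] unfolding slope_control_def by metis
    show ?thesis
    proof (cases "domain (fs n) = {}")
      case True
      then have "S n (0, 0, y, s)" using ys by (simp add: S_def)
      then show ?thesis by blast
    next
      case False
      then obtain x q where "(x, q) \<in> subdiff_graph D (fs n)"
        using assms(3) assms(4,5)[of n] unfolding slope_control_def by blast
      then have "S n (x, q, y, s)" using ys by (simp add: S_def)
      then show ?thesis by blast
    qed
  qed
  have eventual: "\<forall>\<^sub>F n in sequentially. \<exists>w. S n w \<and> P \<epsilon> n w" if "0 < \<epsilon>" for \<epsilon>
  proof -
    have "0 < \<epsilon> / 16" using that by simp
    then obtain \<rho> where \<rho>: "0 < \<rho>" "\<And>x. x \<in> cball z \<rho> \<Longrightarrow>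
        f z + ereal (blinfun_apply p (x - z) - \<epsilon> / 16 * norm (x - z)) \<le> f x"
      using frechet_subdiff_local_minorant[OF assms(6,8)] by metis
    \<comment> \<open>On \<open>cball z (2 * r)\<close> the loss is at most \<open>\<epsilon> * r / 8\<close>, so lowering by \<open>\<epsilon> * r / 4\<close> leaves a margin.  With
        another \<open>\<epsilon> * r / 8\<close> for the recovery sequence the total is \<open>\<eta> = 3 * \<epsilon> * r / 8\<close>; slope \<open>3 * \<epsilon> / 4\<close>
        then costs a displacement of \<open>r / 2\<close>.  The last bound on \<open>r\<close> controls \<open>p\<close> on the ball.\<close>
    define r where "r = Min {\<rho> / 2, \<epsilon>, 1, \<epsilon> / (4 * (norm p + 1))}"
    have r: "0 < r" "2 * r \<le> \<rho>" "r \<le> \<epsilon>" "r \<le> 1" "r * (norm p + 1) \<le> \<epsilon> / 4"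
    proof -
      have p1: "0 < norm p + 1" using norm_ge_zero[of p] by linarith
      show "0 < r" using that \<rho>(1) p1 by (simp add: r_def)
      have "r \<le> \<epsilon> / (4 * (norm p + 1))" "r \<le> \<rho> / 2"
        unfolding r_def by (rule Min_le; simp)+
      then have "r * (4 * (norm p + 1)) \<le> \<epsilon>"
        using p1 by (simp only: pos_le_divide_eq mult_pos_pos zero_less_numeral)
      then show "r * (norm p + 1) \<le> \<epsilon> / 4" by (simp add: algebra_simps)
      show "2 * r \<le> \<rho>" using \<open>r \<le> \<rho> / 2\<close> by simp
      show "r \<le> \<epsilon>" "r \<le> 1" by (simp_all add: r_def)
    qed
    define a where "a x = blinfun_apply p x + (fz - blinfun_apply p z - \<epsilon> * r / 4)" for x
    have "continuous_affine a"
      unfolding continuous_affine_def a_def using blinfun.bounded_linear_right by blast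
    moreover have "ereal (a x + \<epsilon> * r / 8) \<le> f x" if x: "x \<in> cball z (2 * r)" for x
    proof -
      have "\<epsilon> / 16 * norm (x - z) \<le> \<epsilon> / 16 * (2 * r)"
        using x \<open>0 < \<epsilon>\<close> by (intro mult_left_mono) (auto simp: dist_norm norm_minus_commute)
      then have "ereal (a x + \<epsilon> * r / 8) \<le>
          f z + ereal (blinfun_apply p (x - z) - \<epsilon> / 16 * norm (x - z))"
        by (simp add: a_def fz blinfun.diff_right)
      also have "\<dots> \<le> f x" using x r(2) by (intro \<rho>(2)) auto
      finally show ?thesis .
    qed
    ultimately have "\<forall>\<^sub>F n in sequentially. \<forall>x \<in> cball z r. ereal (a x) < ?g n x"
      using slice_convergent_minorant[OF assms(7), of a r "2 * r" "\<epsilon> * r / 8" z] r(1) that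
      by simp
    moreover have "\<forall>\<^sub>F n in sequentially. dist (vs n) z < r / 4"
      using vs(1) r(1) by (intro tendstoD) auto
    moreover have "(\<lambda>n. ?g n (vs n) + ereal (- blinfun_apply p (vs n))) \<longlonglongrightarrow>
        ereal fz + ereal (- blinfun_apply p z)"
      by (intro tendsto_add_ereal_general vs) (auto intro!: tendsto_intros vs)
    then have "\<forall>\<^sub>F n in sequentially. ?g n (vs n) + ereal (- blinfun_apply p (vs n))
        < ereal (fz - blinfun_apply p z + \<epsilon> * r / 8)"
      by (rule order_tendstoD) (use that r(1) in simp)
    ultimately show ?thesis
    proof eventually_elim
      case (elim n)
      let ?k = "\<lambda>x. \<phi>s n x - blinfun_apply p x"
      let ?m = "fz - blinfun_apply p z - \<epsilon> * r / 4"
      have tilt: "fs n x + ereal (?k x) = ?g n x + ereal (- blinfun_apply p x)" for x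
        by (cases "fs n x") auto
      have "continuous_on UNIV (\<phi>s n)"
        using assms(5)[of n] lipschitz_on_continuous_on unfolding convex_lipschitz_def by blast
      then have cont: "continuous_on UNIV ?k" by (intro continuous_intros)
      have pos: "0 < 3 * \<epsilon> / 4" "0 \<le> 3 * \<epsilon> * r / 8" using that r(1) by simp_all
      have low: "ereal ?m \<le> fs n x + ereal (?k x)" if x: "x \<in> cball z r" for x
      proof -
        have "ereal (a x) < ?g n x" using elim(1) x by blast
        then show ?thesis by (cases "fs n x") (auto simp: a_def)
      qed
      have start: "fs n (vs n) + ereal (?k (vs n)) \<le> ereal (?m + 3 * \<epsilon> * r / 8)"
        unfolding tilt using elim(3) by (simp add: algebra_simps less_imp_le)
      have near: "dist z (vs n) + (3 * \<epsilon> * r / 8) / (3 * \<epsilon> / 4) < r"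
        using elim(2) that r(1) by (simp add: dist_commute)
      obtain u where u: "u \<in> ball z r" "u \<in> domain (fs n)"
          "fs n u + ereal (?k u) \<le> fs n (vs n) + ereal (?k (vs n))"
          "slope (\<lambda>x. fs n x + ereal (?k x)) u \<le> ereal (3 * \<epsilon> / 4)"
        by (rule small_slope_near_almost_minimizer[OF assms(4) cont pos low start near])
      have pu: "\<bar>blinfun_apply p u - blinfun_apply p z\<bar> \<le> norm p * r"
      proof -
        have "\<bar>blinfun_apply p (u - z)\<bar> \<le> norm p * norm (u - z)"
          using norm_blinfun[of p "u - z"] by simp
        also have "\<dots> \<le> norm p * r"
          using u(1) by (intro mult_left_mono) (auto simp: dist_norm norm_minus_commute)
        finally show ?thesis by (simp add: blinfun.diff_right)
      qed
      have er: "\<epsilon> * r \<le> \<epsilon>" using r(4) that by simp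
      have pr: "norm p * r \<le> \<epsilon> / 4" using r(1,5) by (simp add: algebra_simps)
      obtain v where v: "fs n u = ereal v"
        using LSC_finite[OF assms(4) u(2)] by blast
      have in_T: "fs n u + ereal (\<phi>s n u) \<in> {ereal (fz - \<epsilon>)<..<ereal (fz + \<epsilon>)}"
      proof -
        have "ereal (a u) < ?g n u" using elim(1) u(1) by simp
        then have "a u < v + \<phi>s n u" by (simp add: v)
        then have lo: "fz - \<epsilon> < v + \<phi>s n u"
          using pu pr er that unfolding a_def by linarith
        have "fs n u + ereal (?k u) < ereal (fz - blinfun_apply p z + \<epsilon> * r / 8)"
          using u(3) elim(3) unfolding tilt by (rule le_less_trans)
        then have "v + ?k u < fz - blinfun_apply p z + \<epsilon> * r / 8" by (simp add: v)
        then have "v + \<phi>s n u < fz + \<epsilon>" using pu pr er that by linarith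
        with lo show ?thesis by (simp add: v)
      qed
      have small: "slope (\<lambda>x. fs n x + ereal (?k x)) u < ereal \<epsilon>"
        using u(4) that by (auto intro: le_less_trans)
      obtain x q y s where
        "(x, q) \<in> subdiff_graph D (fs n)" "(y, s) \<in> subdiff_graph D (\<lambda>y. ereal (\<phi>s n y))"
        "x \<in> ball z r" "y \<in> ball z r"
        "fs n x + ereal (\<phi>s n y) \<in> {ereal (fz - \<epsilon>)<..<ereal (fz + \<epsilon>)}" "norm (q + s - p) < \<epsilon>"
        by (rule slope_control_tilted[OF assms(2,3,4,5) u(2) small open_ball u(1)
              open_greaterThanLessThan in_T])
      then have "S n (x, q, y, s)" "P \<epsilon> n (x, q, y, s)"
        using r(3) by (auto simp: S_def P_def dist_commute)
      then show ?case by blast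
    qed
  qed
  have mono: "P \<epsilon>' n w" if le: "\<epsilon> \<le> \<epsilon>'" and P: "P \<epsilon> n w" for \<epsilon> \<epsilon>' n w
  proof -
    have "ereal (fz - \<epsilon>') < t" if "ereal (fz - \<epsilon>) < t" for t
      by (rule le_less_trans[OF _ that]) (use le in simp)
    moreover have "t < ereal (fz + \<epsilon>')" if "t < ereal (fz + \<epsilon>)" for t
      by (rule less_le_trans[OF that]) (use le in simp)
    ultimately show ?thesis
      using P le by (auto simp: P_def)
  qed
  have "\<exists>w. (\<forall>n. S n (w n)) \<and> (\<forall>\<epsilon>::real. 0 < \<epsilon> \<longrightarrow> (\<forall>\<^sub>F n in sequentially. P \<epsilon> n (w n)))"
  proof (rule diagonal_choice[of S P])
    show "\<exists>w. S n w" for n by (rule fallback)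
    show "\<forall>\<^sub>F n in sequentially. \<exists>w. S n w \<and> P \<epsilon> n w" if "0 < \<epsilon>" for \<epsilon>
      using that by (rule eventual)
    show "P \<epsilon>' n w" if "\<epsilon> \<le> \<epsilon>'" "P \<epsilon> n w" for \<epsilon> \<epsilon>' n w
      using that by (rule mono)
  qed
  then obtain w where w: "\<And>n. S n (w n)" "\<And>\<epsilon>. 0 < \<epsilon> \<Longrightarrow> \<forall>\<^sub>F n in sequentially. P \<epsilon> n (w n)"
    by blast
  define xs where "xs n = fst (w n)" for n
  define ps where "ps n = fst (snd (w n))" for n
  define ys where "ys n = fst (snd (snd (w n)))" for n
  define qs where "qs n = snd (snd (snd (w n)))" for n
  have w_eq: "w n = (xs n, ps n, ys n, qs n)" for n
    by (simp add: xs_def ps_def ys_def qs_def)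
  have close: "\<forall>\<^sub>F n in sequentially. dist (xs n) z < \<epsilon> \<and> dist (ys n) z < \<epsilon> \<and>
      ereal (fz - \<epsilon>) < fs n (xs n) + ereal (\<phi>s n (ys n)) \<and>
      fs n (xs n) + ereal (\<phi>s n (ys n)) < ereal (fz + \<epsilon>) \<and>
      dist (ps n + qs n) p < \<epsilon>" if "0 < \<epsilon>" for \<epsilon>
    using w(2)[OF that] by eventually_elim (simp add: w_eq P_def dist_norm)
  have "(\<lambda>n. fs n (xs n) + ereal (\<phi>s n (ys n))) \<longlonglongrightarrow> f z"
    unfolding fz
  proof (rule order_tendstoI)
    fix l assume "l < ereal fz"
    then obtain b where b: "l < ereal b" "ereal b < ereal fz" using ereal_dense2 by blast
    then have "0 < fz - b" by simp
    from close[OF this] show "\<forall>\<^sub>F n in sequentially. l < fs n (xs n) + ereal (\<phi>s n (ys n))"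
      by eventually_elim (use b(1) in \<open>auto intro: less_trans\<close>)
  next
    fix l assume "ereal fz < l"
    then obtain b where b: "ereal b < l" "ereal fz < ereal b" using ereal_dense2 by blast
    then have "0 < b - fz" by simp
    from close[OF this] show "\<forall>\<^sub>F n in sequentially. fs n (xs n) + ereal (\<phi>s n (ys n)) < l"
      by eventually_elim (use b(1) in \<open>auto intro: less_trans\<close>)
  qed
  moreover have "xs \<longlonglongrightarrow> z" "ys \<longlonglongrightarrow> z" "(\<lambda>n. ps n + qs n) \<longlonglongrightarrow> p"
    by (rule tendstoI, drule close, erule eventually_mono, simp)+
  ultimately show ?thesis
    using w(1) unfolding w_eq S_def by (intro exI[of _ xs] exI[of _ ps] exI[of _ ys] exI[of _ qs]) simp
qed

end
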